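(* For every $n\ge 0$, the Coxeter transformation $\theta$ in the Grothendieck group of the bounded derived category of modules on the Tamari lattice $\mathbb{T}(n)$ satisfies $$\theta^{2n+2}=\mathrm{Id}.$$
   Context: Planar binary trees. $\mathbb{Y}(n)$ is the set of (rooted) planar binary trees with $n$ trivalent vertices and $n+1$ leaves ($n\ge 0$). $|$ is the unique tree of degree $0$, $Y$ the unique tree of degree $1$. For trees $S,T$, $S_YT$ is the tree obtained by grafting $S$ on the left leaf and $T$ on the right leaf of $Y$. Tamari poset. $\mathbb{T}(n)$ is the set $\mathbb{Y}(n)$ with the partial order $\leq$ that is the reflexive transitive closure of the relations $S< T$ whenever $T$ is obtained from $S$ by replacing one subtree of the form $(A_YB)_YC$ by $A_Y(B_YC)$ (with $A,B,C$ planar binary trees, possibly $|$). Coxeter transformation. For a finite poset $P$, let $L$ be the matrix with $L_{v,w}=1$ if $v\le w$ and $0$ otherwise ($v,w\in P$). The Coxeter transformation is the map induced by the Auslander–Reiten translation on the Grothendieck group $K_0$ of the bounded derived category of modules over the Hasse quiver of $P$ (arrows $v\to w$ for $w$ covering $v$) with all commutativity relations (any two paths with the same source and target induce the same map). $K_0$ is free abelian on the classes of simple modules, indexed by $P$, and in this basis the matrix of the Coxeter transformation (acting on column vectors) is known to be $\theta=-L(L^t)^{-1}$. *)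

theory Defs
  imports "HOL-Library.Tree" "HOL-Algebra.Free_Abelian_Groups"
begin

section \<open>Planar binary trees and the Tamari order\<close>

type_synonym pbtree = "unit tree"

abbreviation graft :: "pbtree \<Rightarrow> pbtree \<Rightarrow> pbtree" where
  "graft S T \<equiv> Node S () T"

text \<open>The trivalent vertices of a planar binary tree are its internal nodes, counted by \<^const>\<open>size\<close>.\<close>

definition pbtrees :: "nat \<Rightarrow> pbtree set" where
  "pbtrees n = {T. size T = n}"

text \<open>One subtree, at an arbitrary position, is rewritten.\<close>

inductive tamari_step :: "pbtree \<Rightarrow> pbtree \<Rightarrow> bool" where
  root: "tamari_step (graft (graft A B) C) (graft A (graft B C))"
| left: "tamari_step S S' \<Longrightarrow> tamari_step (graft S T) (graft S' T)"
| right: "tamari_step T T' \<Longrightarrow> tamari_step (graft S T) (graft S T')"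

definition tamari_le :: "pbtree \<Rightarrow> pbtree \<Rightarrow> bool" where
  "tamari_le = tamari_step\<^sup>*\<^sup>*"

lemma finite_pbtrees: "finite (pbtrees n)"
proof (induction n rule: less_induct)
  case (less n)
  have "pbtrees n \<subseteq> insert Leaf ((\<lambda>(l, r). graft l r) ` ((\<Union>i<n. pbtrees i) \<times> (\<Union>i<n. pbtrees i)))"
  proof
    fix T assume "T \<in> pbtrees n"
    then show "T \<in> insert Leaf ((\<lambda>(l, r). graft l r) ` ((\<Union>i<n. pbtrees i) \<times> (\<Union>i<n. pbtrees i)))"
      by (cases T) (auto simp: pbtrees_def image_iff)
  qed
  moreover have "finite (insert Leaf ((\<lambda>(l, r). graft l r) ` ((\<Union>i<n. pbtrees i) \<times> (\<Union>i<n. pbtrees i))))"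
    using less by auto
  ultimately show ?case
    using finite_subset by blast
qed

lemma size_tamari_step: "tamari_step S T \<Longrightarrow> size T = size S"
  by (induction rule: tamari_step.induct) auto

lemma size_tamari_le: "tamari_le S T \<Longrightarrow> size T = size S"
  unfolding tamari_le_def
  by (induction rule: rtranclp_induct) (auto simp: size_tamari_step)

primrec right_weight :: "pbtree \<Rightarrow> nat" where
  "right_weight Leaf = 0"
| "right_weight (Node l a r) = right_weight l + right_weight r + size r"

lemma right_weight_tamari_step: "tamari_step S T \<Longrightarrow> right_weight S < right_weight T"
  by (induction rule: tamari_step.induct) (auto simp: size_tamari_step)

lemma right_weight_tamari_le: "tamari_le S T \<Longrightarrow> S = T \<or> right_weight S < right_weight T"
  unfolding tamari_le_def
  by (induction rule: rtranclp_induct) (use right_weight_tamari_step less_trans in blast)+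

lemma tamari_le_refl: "tamari_le S S"
  and tamari_le_trans: "tamari_le S T \<Longrightarrow> tamari_le T U \<Longrightarrow> tamari_le S U"
  by (auto simp: tamari_le_def)

lemma tamari_le_antisym: "tamari_le S T \<Longrightarrow> tamari_le T S \<Longrightarrow> S = T"
  using right_weight_tamari_le less_asym by blast


section \<open>The Coxeter transformation of a finite poset\<close>

text \<open>
  \<open>P\<close> is a finite set and \<open>leq\<close> a partial order on it. The Grothendieck group of the bounded derived
  category of modules over the Hasse quiver of \<open>P\<close> with all commutativity relations is free
  abelian on the classes of the simple modules, which are indexed by \<open>P\<close>; the class of the simple
  module at \<open>v\<close> is \<open>frag_of v\<close>.
\<close>

abbreviation grothendieck_group :: "'a set \<Rightarrow> ('a \<Rightarrow>\<^sub>0 int) monoid" where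
  "grothendieck_group P \<equiv> free_Abelian_group P"

text \<open>Matrices are indexed by \<open>P\<close> and act on column vectors: the basis element \<open>w\<close> is sent to
  column \<open>w\<close>.\<close>

definition matrix_map :: "'a set \<Rightarrow> ('a \<Rightarrow> 'a \<Rightarrow> int) \<Rightarrow> ('a \<Rightarrow>\<^sub>0 int) \<Rightarrow> ('a \<Rightarrow>\<^sub>0 int)" where
  "matrix_map P M = frag_extend (\<lambda>w. \<Sum>v\<in>P. frag_cmul (M v w) (frag_of v))"

definition order_matrix :: "('a \<Rightarrow> 'a \<Rightarrow> bool) \<Rightarrow> 'a \<Rightarrow> 'a \<Rightarrow> int" where
  "order_matrix leq v w = (if leq v w then 1 else 0)"

definition transpose_matrix :: "('a \<Rightarrow> 'a \<Rightarrow> int) \<Rightarrow> 'a \<Rightarrow> 'a \<Rightarrow> int" where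
  "transpose_matrix M v w = M w v"

text \<open>
  The transformation induced by the Auslander--Reiten translation has matrix \<open>-L (L\<^sup>t)\<^sup>-\<^sup>1\<close> in the
  basis of simple modules, where \<open>L\<close> is the order matrix of \<open>P\<close>. The inverse of \<open>L\<^sup>t\<close> exists over
  the integers (lemma \<open>bij_betw_transpose_order_matrix\<close>), and the resulting map sends the class of
  the indecomposable projective at \<open>v\<close> to minus the class of the indecomposable injective at \<open>v\<close>
  (lemma \<open>coxeter_projective\<close>).
\<close>

definition coxeter_transformation ::
  "'a set \<Rightarrow> ('a \<Rightarrow> 'a \<Rightarrow> bool) \<Rightarrow> ('a \<Rightarrow>\<^sub>0 int) \<Rightarrow> ('a \<Rightarrow>\<^sub>0 int)" where
  "coxeter_transformation P leq x =
     - matrix_map P (order_matrix leq)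
         (inv_into (carrier (grothendieck_group P))
            (matrix_map P (transpose_matrix (order_matrix leq))) x)"

lemma lookup_sum_frag: 
  "poly_mapping.lookup (\<Sum>i\<in>A. f i) u = (\<Sum>i\<in>A. poly_mapping.lookup (f i) u)"
  by (induction A rule: infinite_finite_induct) (auto simp: lookup_add)

lemma lookup_matrix_map:
  assumes "finite P" "Poly_Mapping.keys x \<subseteq> P"
  shows "poly_mapping.lookup (matrix_map P M x) u =
           (if u \<in> P then \<Sum>w\<in>P. M u w * poly_mapping.lookup x w else 0)"
proof -
  have 1: "poly_mapping.lookup (\<Sum>v\<in>P. frag_cmul (M v w) (frag_of v)) u = (if u \<in> P then M u w else 0)" for w
  proof -
    have "poly_mapping.lookup (\<Sum>v\<in>P. frag_cmul (M v w) (frag_of v)) u = (\<Sum>v\<in>P. if v = u then M v w else 0)"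
      unfolding lookup_sum_frag by (rule sum.cong) (auto simp: lookup_single when_def)
    then show ?thesis using assms(1) by simp
  qed
  have "poly_mapping.lookup (matrix_map P M x) u =
      (\<Sum>w\<in>Poly_Mapping.keys x. poly_mapping.lookup x w * (if u \<in> P then M u w else 0))"
    unfolding matrix_map_def frag_extend_def
    by (subst lookup_sum_frag) (simp only: lookup_frag_cmul 1)
  also have "\<dots> = (\<Sum>w\<in>P. poly_mapping.lookup x w * (if u \<in> P then M u w else 0))"
    by (rule sum.mono_neutral_left) (use assms in \<open>auto simp: in_keys_iff\<close>)
  finally show ?thesis by (simp add: mult.commute)
qed

lemma keys_matrix_map:
  assumes "finite P" "Poly_Mapping.keys x \<subseteq> P"
  shows "Poly_Mapping.keys (matrix_map P M x) \<subseteq> P"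
  using lookup_matrix_map[OF assms] by (auto simp: in_keys_iff split: if_splits)

locale finite_poset =
  fixes P :: "'a set" and leq :: "'a \<Rightarrow> 'a \<Rightarrow> bool"
  assumes finite: "finite P"
    and refl: "v \<in> P \<Longrightarrow> leq v v"
    and antisym: "v \<in> P \<Longrightarrow> w \<in> P \<Longrightarrow> leq v w \<Longrightarrow> leq w v \<Longrightarrow> v = w"
    and trans: "u \<in> P \<Longrightarrow> v \<in> P \<Longrightarrow> w \<in> P \<Longrightarrow> leq u v \<Longrightarrow> leq v w \<Longrightarrow> leq u w"
begin

abbreviation "K \<equiv> carrier (grothendieck_group P)"
abbreviation "L \<equiv> matrix_map P (order_matrix leq)"
abbreviation "Lt \<equiv> matrix_map P (transpose_matrix (order_matrix leq))"

lemma inj_on_transpose_order_matrix: "inj_on Lt K"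
proof (rule inj_onI)
  fix x y assume xy: "x \<in> K" "y \<in> K" "Lt x = Lt y"
  define z where "z = x - y"
  have z: "Poly_Mapping.keys z \<subseteq> P"
    using xy keys_diff[of x y] by (auto simp: z_def)
  have z0: "Lt z = 0"
    using xy(3) by (simp add: z_def matrix_map_def frag_extend_diff)
  have "z = 0"
  proof (rule ccontr)
    assume "z \<noteq> 0"
    then have ne: "Poly_Mapping.keys z \<noteq> {}" by simp
    define R where "R a b \<longleftrightarrow> a \<in> P \<and> b \<in> P \<and> leq a b \<and> a \<noteq> b" for a b
    have "transp_on (Poly_Mapping.keys z) R" "asymp_on (Poly_Mapping.keys z) R"
      by (auto simp: R_def transp_on_def asymp_on_def dest: antisym intro: trans)
    then obtain m where m: "m \<in> Poly_Mapping.keys z" "\<forall>a\<in>Poly_Mapping.keys z. \<not> R a m"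
      using Finite_Set.bex_min_element[OF finite_keys] ne by (metis R_def)
    then have mP: "m \<in> P" using z by auto
    have "poly_mapping.lookup (Lt z) m = (\<Sum>w\<in>P. if w = m then poly_mapping.lookup z m else 0)"
      unfolding lookup_matrix_map[OF finite z] using mP m(2) z
      by (auto simp: transpose_matrix_def order_matrix_def R_def in_keys_iff refl intro!: sum.cong)
    also have "\<dots> = poly_mapping.lookup z m" using mP finite by simp
    finally show False using z0 m(1) by (simp add: in_keys_iff)
  qed
  then show "x = y" by (simp add: z_def)
qed

lemma matrix_map_closed: "x \<in> K \<Longrightarrow> matrix_map P M x \<in> K"
  using keys_matrix_map[OF finite] by auto

lemma surj_on_transpose_order_matrix: "Lt ` K = K"
proof
  show "Lt ` K \<subseteq> K" using matrix_map_closed by blast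
  have gen: "v \<in> P \<Longrightarrow> frag_of v \<in> Lt ` K" for v
  proof (induction "card {u \<in> P. leq v u}" arbitrary: v rule: less_induct)
    case less
    let ?U = "{u \<in> P. leq v u \<and> u \<noteq> v}"
    have "\<exists>x\<in>K. Lt x = frag_of u" if u: "u \<in> ?U" for u
    proof -
      have "{w \<in> P. leq u w} \<subset> {w \<in> P. leq v w}"
        using u less.prems antisym[of u v] refl by (auto intro: trans)
      then have "card {w \<in> P. leq u w} < card {w \<in> P. leq v w}"
        using finite by (intro psubset_card_mono) auto
      then show ?thesis using less.hyps[of u] u by (auto simp: image_iff)
    qed
    then obtain g where g: "\<And>u. u \<in> ?U \<Longrightarrow> g u \<in> K \<and> Lt (g u) = frag_of u" by metis
    let ?x = "frag_of v - (\<Sum>u\<in>?U. g u)"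
    have "Poly_Mapping.keys (\<Sum>u\<in>?U. g u) \<subseteq> P"
      using g by (intro order_trans[OF keys_sum] UN_least) simp
    then have K: "?x \<in> K"
      using keys_diff[of "frag_of v" "\<Sum>u\<in>?U. g u"] less.prems by auto
    have "Lt (frag_of v) = (\<Sum>u\<in>P. frag_cmul (order_matrix leq v u) (frag_of u))"
      by (simp add: matrix_map_def transpose_matrix_def)
    also have "\<dots> = (\<Sum>u\<in>insert v ?U. frag_of u)"
      using less.prems finite
      by (intro sum.mono_neutral_cong_right) (auto simp: order_matrix_def refl)
    finally have v: "Lt (frag_of v) = frag_of v + (\<Sum>u\<in>?U. frag_of u)"
      using finite by simp
    have "Lt (\<Sum>u\<in>?U. g u) = (\<Sum>u\<in>?U. Lt (g u))"
      unfolding matrix_map_def using finite by (simp add: frag_extend_sum o_def)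
    also have "\<dots> = (\<Sum>u\<in>?U. frag_of u)" using g by (intro sum.cong) auto
    finally have "Lt ?x = frag_of v"
      using v by (simp add: matrix_map_def frag_extend_diff)
    then show ?case by (rule image_eqI[OF sym K])
  qed
  show "K \<subseteq> Lt ` K"
  proof
    fix x assume "x \<in> K"
    then have "Poly_Mapping.keys x \<subseteq> P" by simp
    then show "x \<in> Lt ` K"
    proof (induction rule: frag_induction)
      case zero
      have "0 = Lt 0" "0 \<in> K" by (auto simp: matrix_map_def)
      then show ?case by (rule image_eqI)
    next
      case (one v)
      then show ?case using gen by blast
    next
      case (diff a b)
      then obtain y z where yz: "y \<in> K" "z \<in> K" "a = Lt y" "b = Lt z" by blast
      show ?case
      proof (rule image_eqI)
        show "a - b = Lt (y - z)" using yz by (simp add: matrix_map_def frag_extend_diff)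
        show "y - z \<in> K" using yz keys_diff[of y z] by auto
      qed
    qed
  qed
qed

lemma bij_betw_transpose_order_matrix: "bij_betw Lt K K"
  using inj_on_transpose_order_matrix surj_on_transpose_order_matrix by (simp add: bij_betw_def)

text \<open>The indecomposable projective (resp. injective) module at \<open>v\<close> has each simple module at
  \<open>w \<ge> v\<close> (resp. \<open>w \<le> v\<close>) as a composition factor exactly once.\<close>

lemma coxeter_projective:
  assumes "v \<in> P"
  shows "coxeter_transformation P leq (\<Sum>w\<in>{w\<in>P. leq v w}. frag_of w) = - (\<Sum>w\<in>{w\<in>P. leq w v}. frag_of w)"
proof -
  have "Lt (frag_of v) = (\<Sum>w\<in>{w\<in>P. leq v w}. frag_of w)"
    unfolding matrix_map_def frag_extend_of transpose_matrix_def using finite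
    by (intro sum.mono_neutral_cong_right) (auto simp: order_matrix_def)
  moreover have "L (frag_of v) = (\<Sum>w\<in>{w\<in>P. leq w v}. frag_of w)"
    unfolding matrix_map_def frag_extend_of using finite
    by (intro sum.mono_neutral_cong_right) (auto simp: order_matrix_def)
  moreover have "frag_of v \<in> K" using assms by simp
  ultimately show ?thesis
    unfolding coxeter_transformation_def
    using inv_into_f_f[OF inj_on_transpose_order_matrix] by metis
qed

end

lemma finite_poset_tamari: "finite_poset (pbtrees n) tamari_le"
proof
  show "finite (pbtrees n)" by (rule finite_pbtrees)
qed (rule tamari_le_refl, erule (1) tamari_le_antisym, erule (1) tamari_le_trans)

end

theory Submission
  imports Defs Complex_Main
begin

text \<open>
  Label the leaves of a tree with \<open>n\<close> vertices by variables \<open>x\<^sub>0, \<dots>, x\<^sub>n\<close> and send it to the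
  product of \<open>1 / (x\<^sub>b - x\<^sub>a)\<close> over its vertices, \<open>a\<close> and \<open>b\<close> being the extreme leaves above the
  vertex. These rational functions are linearly independent, and the sum over an upper or a lower set
  of the Tamari order again factors into a product of \<open>n\<close> inverse differences. On the upper sets
  \<open>\<theta>\<close> is known, and the identity
  \<open>1 / ((b - a)(c - a)) + 1 / ((c - b)(c - a)) = 1 / ((b - a)(c - b))\<close> propagates this knowledge
  first to single trees, by a recursion over grafting, and from there to the lower sets. The outcome
  is that \<open>\<theta>\<^sup>2\<close> acts as \<open>(-1)\<^sup>n\<close> times the cyclic rotation of \<open>x\<^sub>0, \<dots>, x\<^sub>n\<close>, which has order
  \<open>n + 1\<close>; the sign disappears because \<open>n (n + 1)\<close> is even.
\<close>

section \<open>Rational functions of trees\<close>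

primrec tree_frac :: "pbtree \<Rightarrow> (nat \<Rightarrow> real) \<Rightarrow> real" where
  "tree_frac Leaf x = 1"
| "tree_frac (Node l a r) x =
     tree_frac l x * tree_frac r (\<lambda>i. x (i + Suc (size l))) / (x (Suc (size l + size r)) - x 0)"

text \<open>The product form of the sum over the upper set of a tree (\<open>sum_tamari_up\<close>):
  each vertex factor starts at the last leaf of its left subtree instead of the first leaf above the
  vertex.\<close>

primrec upset_frac :: "pbtree \<Rightarrow> (nat \<Rightarrow> real) \<Rightarrow> real" where
  "upset_frac Leaf x = 1"
| "upset_frac (Node l a r) x =
     upset_frac l x * upset_frac r (\<lambda>i. x (i + Suc (size l))) / (x (Suc (size l + size r)) - x (size l))"

text \<open>Mirror image of \<open>upset_frac\<close>, for lower sets: each vertex factor ends at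
  the first leaf of its right subtree.\<close>

primrec downset_frac :: "pbtree \<Rightarrow> (nat \<Rightarrow> real) \<Rightarrow> real" where
  "downset_frac Leaf x = 1"
| "downset_frac (Node l a r) x =
     downset_frac l x * downset_frac r (\<lambda>i. x (i + Suc (size l))) / (x (Suc (size l)) - x 0)"

lemma tree_frac_cong: "(\<And>i. i \<le> size T \<Longrightarrow> x i = y i) \<Longrightarrow> tree_frac T x = tree_frac T y"
proof (induction T arbitrary: x y)
  case (Node l a r)
  show ?case using Node.IH(1)[of x y] Node.IH(2)[of "\<lambda>i. x (i + Suc (size l))" "\<lambda>i. y (i + Suc (size l))"] Node.prems
    by simp
qed simp

lemma upset_frac_cong: "(\<And>i. i \<le> size T \<Longrightarrow> x i = y i) \<Longrightarrow> upset_frac T x = upset_frac T y"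
proof (induction T arbitrary: x y)
  case (Node l a r)
  show ?case using Node.IH(1)[of x y] Node.IH(2)[of "\<lambda>i. x (i + Suc (size l))" "\<lambda>i. y (i + Suc (size l))"] Node.prems
    by simp
qed simp

lemma tree_frac_translate: "tree_frac T (\<lambda>i. x i - t) = tree_frac T x"
  by (induction T arbitrary: x) simp_all

text \<open>Reversing the leaves negates the difference at each of the \<open>n\<close> vertices,
  whence the sign.\<close>

lemma tree_frac_mirror:
  "size T = n \<Longrightarrow> tree_frac (mirror T) x = (-1) ^ n * tree_frac T (\<lambda>i. x (n - i))"
proof (induction T arbitrary: n x)
  case (Node l a r)
  have "tree_frac l (\<lambda>i. x (size l - i + Suc (size r))) = tree_frac l (\<lambda>i. x (n - i))"
    using Node.prems by (intro tree_frac_cong arg_cong[of _ _ x]) simp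
  moreover have "n - (i + Suc (size l)) = size r - i" for i
    using Node.prems by simp
  moreover have "(-1 :: real) ^ n = - ((-1) ^ size l * (-1) ^ size r)"
    using Node.prems by (auto simp: power_add)
  moreover have "u / (x n - x 0) = - (u / (x 0 - x n))" for u
    by (metis minus_diff_eq minus_divide_right)
  ultimately show ?case
    using Node.IH[OF refl] Node.prems by (simp add: ac_simps)
qed simp

lemma downset_frac_mirror:
  "size T = n \<Longrightarrow> downset_frac T x = (-1) ^ n * upset_frac (mirror T) (\<lambda>i. x (n - i))"
proof (induction T arbitrary: n x)
  case (Node l a r)
  have "upset_frac (mirror l) (\<lambda>i. x (n - (i + Suc (size r)))) = upset_frac (mirror l) (\<lambda>i. x (size l - i))"
    using Node.prems by (intro upset_frac_cong arg_cong[of _ _ x]) simp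
  moreover have "upset_frac (mirror r) (\<lambda>i. x (n - i)) = upset_frac (mirror r) (\<lambda>i. x (size r - i + Suc (size l)))"
    using Node.prems by (intro upset_frac_cong arg_cong[of _ _ x]) simp
  moreover have "n - Suc (size l + size r) = 0" "n - size r = Suc (size l)"
    using Node.prems by simp_all
  moreover have "(-1 :: real) ^ n = - ((-1) ^ size l * (-1) ^ size r)"
    using Node.prems by (auto simp: power_add)
  moreover have "u / (x (Suc (size l)) - x 0) = - (u / (x 0 - x (Suc (size l))))" for u
    by (metis minus_diff_eq minus_divide_right)
  ultimately show ?case
    using Node.IH[OF refl] by (simp add: ac_simps)
qed simp

section \<open>Partial fractions and points with distinct coordinates\<close>

lemma triangle:
  fixes u a b c :: real
  assumes "a \<noteq> b" "b \<noteq> c" "a \<noteq> c"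
  shows "u / (b - a) / (c - a) + u / (c - b) / (c - a) = u / (b - a) / (c - b)"
proof -
  have "b - a \<noteq> 0" "c - b \<noteq> 0" "c - a \<noteq> 0" using assms by auto
  then show ?thesis by (simp add: divide_simps) (simp add: algebra_simps)
qed

lemma inj_on_distinct: "inj_on x A \<Longrightarrow> i \<in> A \<Longrightarrow> j \<in> A \<Longrightarrow> i \<noteq> j \<Longrightarrow> x i \<noteq> x j"
  by (auto dest: inj_onD)

lemma inj_on_shift:
  fixes x :: "nat \<Rightarrow> 'a"
  assumes "inj_on x {..n}" "k + l \<le> n"
  shows "inj_on (\<lambda>i. x (i + k)) {..l}"
proof (rule inj_onI)
  fix i j assume "i \<in> {..l}" "j \<in> {..l}" "x (i + k) = x (j + k)"
  then show "i = j" using assms inj_onD[of x "{..n}" "i + k" "j + k"] by auto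
qed

lemma inj_on_initial: "inj_on x {..n} \<Longrightarrow> k \<le> n \<Longrightarrow> inj_on x {..k::nat}"
  by (erule inj_on_subset) simp

lemma tamari_le_step: "tamari_step S T \<Longrightarrow> tamari_le S T"
  unfolding tamari_le_def by (rule r_into_rtranclp)

lemma tamari_le_graft:
  assumes "tamari_le A A'" "tamari_le B B'"
  shows "tamari_le (graft A B) (graft A' B')"
proof -
  have "tamari_le (graft A B) (graft A' B)"
    using assms(1) unfolding tamari_le_def
    by (induction rule: rtranclp_induct) (auto intro: tamari_step.left rtranclp.rtrancl_into_rtrancl)
  moreover have "tamari_le (graft A' B) (graft A' B')"
    using assms(2) unfolding tamari_le_def
    by (induction rule: rtranclp_induct) (auto intro: tamari_step.right rtranclp.rtrancl_into_rtrancl)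
  ultimately show ?thesis by (rule tamari_le_trans)
qed

section \<open>Sums over upper and lower sets of the Tamari order\<close>

text \<open>\<open>U\<close> arises from \<open>A\<^sub>YB\<close> by moving the root vertex, together with \<open>B\<close>, up along the right
  spine of \<open>A\<close>.\<close>

inductive slide :: "pbtree \<Rightarrow> pbtree \<Rightarrow> pbtree \<Rightarrow> bool" where
  here: "slide A B (graft A B)"
| below: "slide A B U \<Longrightarrow> slide (graft C A) B (graft C U)"

inductive_cases slide_graftE: "slide A B (graft C D)"

lemma tamari_le_slide: "slide A B U \<Longrightarrow> tamari_le (graft A B) U"
proof (induction rule: slide.induct)
  case (below A B U C)
  have "tamari_le (graft (graft C A) B) (graft C (graft A B))"
    by (intro tamari_le_step tamari_step.root)
  from this tamari_le_graft[OF tamari_le_refl below.IH] show ?case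
    by (rule tamari_le_trans)
qed (rule tamari_le_refl)

text \<open>The moved vertex lies on the right spine of \<open>U\<close>, and \<open>size A\<close>
  counts the vertices before it in infix order, so it singles out that vertex.\<close>

lemma slide_unique:
  "slide A B U \<Longrightarrow> slide A' B' U \<Longrightarrow> size A = size A' \<Longrightarrow> A = A' \<and> B = B'"
proof (induction arbitrary: A' B' rule: slide.induct)
  case (here A B)
  from here.prems(1) show ?case by (rule slide_graftE) (use here.prems(2) in simp_all)
next
  case (below A B U C)
  note IH = below.IH and size = below.prems(2)
  from below.prems(1) show ?case
  proof (rule slide_graftE)
    assume "C = A'" then show ?thesis using size by simp
  next
    fix A'' assume "A' = graft C A''" "slide A'' B' U"
    then show ?thesis using IH[of A'' B'] size by simp
  qed
qed

text \<open>A rotation of \<open>U\<close> either takes the moved vertex one place further along the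
  right spine or happens inside \<open>A\<close> or \<open>B\<close>.\<close>

lemma tamari_step_slide:
  "slide A B U \<Longrightarrow> tamari_step U V \<Longrightarrow> \<exists>A' B'. tamari_le A A' \<and> tamari_le B B' \<and> slide A' B' V"
proof (induction arbitrary: V rule: slide.induct)
  case (here A B)
  then show ?case
  proof cases
    case (root C D)
    then show ?thesis using tamari_le_refl slide.intros by blast
  qed (use slide.here tamari_le_refl tamari_le_step in blast)+
next
  case (below A B U C)
  from below.prems show ?case
  proof cases
    case (root D E)
    have "slide (graft D (graft E A)) B V"
      unfolding root using below.hyps by (intro slide.below)
    moreover have "tamari_le (graft C A) (graft D (graft E A))"
      unfolding root by (intro tamari_le_step tamari_step.root)
    ultimately show ?thesis using tamari_le_refl by blast
  next
    case (left C')
    have "tamari_le (graft C A) (graft C' A)"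
      using left by (intro tamari_le_step tamari_step.left)
    then show ?thesis using slide.below[OF below.hyps] left tamari_le_refl by blast
  next
    case (right U')
    then show ?thesis using below.IH slide.below tamari_le_graft tamari_le_refl by blast
  qed
qed

lemma tamari_le_graft_iff:
  "tamari_le (graft A B) U \<longleftrightarrow> (\<exists>A' B'. tamari_le A A' \<and> tamari_le B B' \<and> slide A' B' U)"
proof
  assume "tamari_le (graft A B) U"
  then show "\<exists>A' B'. tamari_le A A' \<and> tamari_le B B' \<and> slide A' B' U"
    unfolding tamari_le_def[THEN fun_cong, THEN fun_cong, of "graft A B" U]
  proof (induction rule: rtranclp_induct)
    case base
    show ?case using tamari_le_refl slide.here by blast
  next
    case (step U V)
    then obtain A' B' where le: "tamari_le A A'" "tamari_le B B'" and "slide A' B' U" by blast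
    from tamari_step_slide[OF this(3) step.hyps(2)] obtain A'' B''
      where "tamari_le A' A''" "tamari_le B' B''" "slide A'' B'' V" by blast
    with le show ?case by (blast intro: tamari_le_trans)
  qed
next
  assume "\<exists>A' B'. tamari_le A A' \<and> tamari_le B B' \<and> slide A' B' U"
  then obtain A' B' where "tamari_le A A'" "tamari_le B B'" "slide A' B' U" by blast
  then show "tamari_le (graft A B) U"
    by (meson tamari_le_graft tamari_le_slide tamari_le_trans)
qed

lemma finite_tamari_up: "finite {U. tamari_le T U}"
  by (rule finite_subset[OF _ finite_pbtrees[of "size T"]]) (auto simp: pbtrees_def size_tamari_le)

lemma finite_slide: "finite {U. slide A B U}"
  by (rule finite_subset[OF _ finite_tamari_up]) (auto dest: tamari_le_slide)

text \<open>Induction along the right spine of \<open>A\<close>: the unmoved tree and all the moved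
  ones share the root factor \<open>1 / (x_n - x_0)\<close>, and \<open>triangle\<close> merges
  their two contributions.\<close>

lemma sum_slide:
  "inj_on x {..Suc (size A + size B)} \<Longrightarrow>
   (\<Sum>U | slide A B U. tree_frac U x) =
     tree_frac A x * tree_frac B (\<lambda>i. x (i + Suc (size A))) / (x (Suc (size A + size B)) - x (size A))"
proof (induction A arbitrary: x)
  case Leaf
  have "{U. slide Leaf B U} = {graft Leaf B}"
    by (auto elim: slide.cases intro: slide.here)
  then show ?case by simp
next
  case (Node C a A)
  let ?k = "Suc (size C)" and ?n = "Suc (Suc (size C + size A + size B))"
  have set: "{U. slide (graft C A) B U} = insert (graft (graft C A) B) (graft C ` {U. slide A B U})"
    by (auto elim: slide.cases intro: slide.intros)
  have new: "graft (graft C A) B \<notin> graft C ` {U. slide A B U}"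
  proof
    assume "graft (graft C A) B \<in> graft C ` {U. slide A B U}"
    then have "size (graft C A) = size C" by auto
    then show False by simp
  qed
  have size: "slide A B U \<Longrightarrow> size U = Suc (size A + size B)" for U
    using size_tamari_le[OF tamari_le_slide] by simp
  let ?y = "\<lambda>i. x (i + ?k)"
  have inj: "inj_on ?y {..Suc (size A + size B)}"
    by (rule inj_on_shift[OF Node.prems]) simp
  have "(\<Sum>U | slide (graft C A) B U. tree_frac U x) =
      tree_frac (graft (graft C A) B) x + (\<Sum>U | slide A B U. tree_frac (graft C U) x)"
    unfolding set using new finite_slide by (simp add: sum.reindex inj_on_def)
  also have "(\<Sum>U | slide A B U. tree_frac (graft C U) x) =
      (\<Sum>U | slide A B U. tree_frac C x / (x ?n - x 0) * tree_frac U ?y)"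
    by (rule sum.cong) (auto simp: size ac_simps)
  also have "\<dots> = tree_frac C x / (x ?n - x 0) * (\<Sum>U | slide A B U. tree_frac U ?y)"
    by (simp add: sum_distrib_left)
  also note Node.IH(2)[OF inj]
  finally show ?case
    using triangle[of "x 0" "x (Suc (size C + size A))" "x ?n"
        "tree_frac C x * tree_frac A ?y * tree_frac B (\<lambda>i. x (i + Suc (Suc (size C + size A))))"]
      inj_on_distinct[OF Node.prems]
    by (simp add: ac_simps)
qed

text \<open>\<open>tamari_le_graft_iff\<close> splits the upper set into fibres over pairs
  \<open>(A', B')\<close>. The denominator in \<open>sum_slide\<close> depends only on the sizes, so
  the sum over the pairs factors.\<close>

lemma sum_tamari_up:
  "inj_on x {..size T} \<Longrightarrow> (\<Sum>U | tamari_le T U. tree_frac U x) = upset_frac T x"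
proof (induction T arbitrary: x)
  case Leaf
  have "{U. tamari_le Leaf U} = {Leaf}"
    using size_tamari_le tamari_le_refl by fastforce
  then show ?case by simp
next
  case (Node A a B)
  let ?I = "{A'. tamari_le A A'} \<times> {B'. tamari_le B B'}"
  let ?S = "\<lambda>(A', B'). {U. slide A' B' U}"
  let ?y = "\<lambda>i. x (i + Suc (size A))"
  let ?d = "x (Suc (size A + size B)) - x (size A)"
  have inj: "inj_on x {..size A}" "inj_on ?y {..size B}"
    using inj_on_initial[OF Node.prems, of "size A"] inj_on_shift[OF Node.prems, of "Suc (size A)" "size B"]
    by simp_all
  have "{U. tamari_le (graft A B) U} = (\<Union>p\<in>?I. ?S p)"
    by (auto simp: tamari_le_graft_iff)
  \<comment> \<open>All \<open>A'\<close> have the size of \<open>A\<close>, so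
    \<open>slide_unique\<close> makes the fibres disjoint.\<close>
  then have "(\<Sum>U | tamari_le (graft A B) U. tree_frac U x) = (\<Sum>p\<in>?I. \<Sum>U\<in>?S p. tree_frac U x)"
    using finite_slide finite_tamari_up
    by (simp, subst sum.UNION_disjoint) (auto dest!: size_tamari_le dest: slide_unique)
  also have "\<dots> = (\<Sum>p\<in>?I. tree_frac (fst p) x * tree_frac (snd p) ?y / ?d)"
    using Node.prems by (intro sum.cong) (auto simp: sum_slide dest!: size_tamari_le)
  also have "\<dots> = (\<Sum>A' | tamari_le A A'. tree_frac A' x) * (\<Sum>B' | tamari_le B B'. tree_frac B' ?y) / ?d"
    by (simp add: sum_product sum.cartesian_product sum_divide_distrib case_prod_unfold)
  finally show ?case
    using Node.IH(1)[OF inj(1)] Node.IH(2)[OF inj(2)] by simp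
qed

section \<open>Lower sets by reflection\<close>

lemma tamari_step_mirror: "tamari_step S T \<Longrightarrow> tamari_step (mirror T) (mirror S)"
  by (induction rule: tamari_step.induct) (auto intro: tamari_step.intros)

lemma tamari_le_mirror: "tamari_le S T \<Longrightarrow> tamari_le (mirror T) (mirror S)"
  unfolding tamari_le_def
  by (induction rule: rtranclp_induct) (auto dest: tamari_step_mirror intro: converse_rtranclp_into_rtranclp)

text \<open>\<open>mirror\<close> reverses the order and turns lower sets into upper sets; the sign
  from \<open>tree_frac_mirror\<close> is the one in \<open>downset_frac_mirror\<close>.\<close>

lemma sum_tamari_down:
  assumes "inj_on x {..size T}"
  shows "(\<Sum>U | tamari_le U T. tree_frac U x) = downset_frac T x"
proof -
  let ?n = "size T" and ?y = "\<lambda>i. x (size T - i)"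
  have eq: "{U. tamari_le U T} = mirror ` {U. tamari_le (mirror T) U}"
    using tamari_le_mirror by (force intro: rev_image_eqI)
  have "(\<Sum>U | tamari_le U T. tree_frac U x) = (\<Sum>U | tamari_le (mirror T) U. tree_frac (mirror U) x)"
    unfolding eq by (subst sum.reindex) (auto intro: inj_on_inverseI[of _ mirror])
  also have "\<dots> = (\<Sum>U | tamari_le (mirror T) U. (-1) ^ ?n * tree_frac U ?y)"
    using size_tamari_le by (intro sum.cong tree_frac_mirror) auto
  also have "\<dots> = (-1) ^ ?n * upset_frac (mirror T) ?y"
  proof -
    have "inj_on ?y {..size (mirror T)}"
      using assms by (intro inj_onI) (auto dest!: inj_onD)
    from sum_tamari_up[OF this] show ?thesis by (simp add: sum_distrib_left[symmetric])
  qed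
  finally show ?thesis using downset_frac_mirror[of T] by simp
qed

section \<open>Linear independence\<close>

lemma tree_frac_convergent:
  assumes "\<And>i j. ((\<lambda>t. 1 / (z t j - z t i)) \<longlongrightarrow> e i j) F"
  shows "\<exists>L. ((\<lambda>t. tree_frac T (z t)) \<longlongrightarrow> L) F"
  using assms
proof (induction T arbitrary: z e)
  case (Node A a B)
  let ?k = "Suc (size A)"
  obtain L where "((\<lambda>t. tree_frac A (z t)) \<longlongrightarrow> L) F"
    using Node.IH(1)[of z, OF Node.prems] by blast
  moreover obtain M where "((\<lambda>t. tree_frac B (\<lambda>i. z t (i + ?k))) \<longlongrightarrow> M) F"
    using Node.IH(2)[of "\<lambda>t i. z t (i + ?k)", OF Node.prems] by blast
  ultimately have "((\<lambda>t. tree_frac A (z t) * tree_frac B (\<lambda>i. z t (i + ?k)) *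
      (1 / (z t (Suc (size A + size B)) - z t 0))) \<longlongrightarrow> L * M * e 0 (Suc (size A + size B))) F"
    by (intro tendsto_mult Node.prems)
  then show ?case by auto
qed auto

text \<open>The root factor tends to 0 while the remaining product converges.\<close>

lemma tree_frac_tendsto_0:
  assumes lim: "\<And>i j. ((\<lambda>t. 1 / (z t j - z t i)) \<longlongrightarrow> e i j) F"
    and "T \<noteq> Leaf" "e 0 (size T) = 0"
  shows "((\<lambda>t. tree_frac T (z t)) \<longlongrightarrow> 0) F"
proof -
  obtain A B where T: "T = graft A B" using \<open>T \<noteq> Leaf\<close> by (cases T) auto
  let ?k = "Suc (size A)"
  obtain L where "((\<lambda>t. tree_frac A (z t)) \<longlongrightarrow> L) F"
    using tree_frac_convergent[of z, OF lim] by blast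
  moreover obtain M where "((\<lambda>t. tree_frac B (\<lambda>i. z t (i + ?k))) \<longlongrightarrow> M) F"
    using tree_frac_convergent[of "\<lambda>t i. z t (i + ?k)", OF lim] by blast
  ultimately have "((\<lambda>t. tree_frac A (z t) * tree_frac B (\<lambda>i. z t (i + ?k)) *
      (1 / (z t (size T) - z t 0))) \<longlongrightarrow> L * M * e 0 (size T)) F"
    by (intro tendsto_mult lim)
  then show ?thesis using assms(3) by (simp add: T)
qed

lemma sum_graft:
  "(\<Sum>T\<in>pbtrees (Suc (k + l)). if size (left T) = k then f (left T) (right T) else 0) =
   (\<Sum>A\<in>pbtrees k. \<Sum>B\<in>pbtrees l. f A B)" (is "?lhs = ?rhs")
proof -
  let ?g = "\<lambda>(A, B). graft A B"
  have "?lhs = (\<Sum>T\<in>?g ` (pbtrees k \<times> pbtrees l). f (left T) (right T))"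
  proof (rule sum.mono_neutral_cong_right)
    show "\<forall>T\<in>pbtrees (Suc (k + l)) - ?g ` (pbtrees k \<times> pbtrees l).
        (if size (left T) = k then f (left T) (right T) else 0) = 0"
    proof
      fix T assume T: "T \<in> pbtrees (Suc (k + l)) - ?g ` (pbtrees k \<times> pbtrees l)"
      then obtain A B where AB: "T = graft A B" by (cases T) (auto simp: pbtrees_def)
      have "size A \<noteq> k"
      proof
        assume "size A = k"
        then have "(A, B) \<in> pbtrees k \<times> pbtrees l" using T AB by (auto simp: pbtrees_def)
        then show False using T AB by force
      qed
      then show "(if size (left T) = k then f (left T) (right T) else 0) = 0" using AB by simp
    qed
  qed (auto simp: finite_pbtrees, auto simp: pbtrees_def)
  also have "\<dots> = (\<Sum>(A, B)\<in>pbtrees k \<times> pbtrees l. f A B)"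
    by (subst sum.reindex) (auto simp: inj_on_def case_prod_unfold)
  finally show ?thesis by (simp add: sum.cartesian_product)
qed

text \<open>Translate \<open>x\<^sub>0, \<dots>, x\<^sub>k\<close> to infinity relative to the other variables: after removal of the
  root factor, only the trees whose left subtree has \<open>k\<close> vertices survive in the limit.\<close>

lemma tree_frac_separate:
  fixes c :: "pbtree \<Rightarrow> real"
  assumes zero: "\<And>x. inj_on x {..Suc (k + l)} \<Longrightarrow> (\<Sum>T\<in>pbtrees (Suc (k + l)). c T * tree_frac T x) = 0"
    and y: "inj_on y {..k}" and w: "inj_on w {..l}"
  shows "(\<Sum>A\<in>pbtrees k. \<Sum>B\<in>pbtrees l. c (graft A B) * (tree_frac A y * tree_frac B w)) = 0"
proof -
  let ?n = "Suc (k + l)"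
  \<comment> \<open>\<open>v\<close> is \<open>y\<close> followed by \<open>w\<close>,
    \<open>z t\<close> moves the first block by \<open>-t\<close>, and \<open>e\<close> collects the
    limits of the inverse differences, 0 across the blocks. On the diagonal both sides are
    \<open>1 / 0 = 0\<close>.\<close>
  define v where "v i = (if i \<le> k then y i else w (i - Suc k))" for i
  define z where "z t i = (if i \<le> k then v i - t else v i)" for t i
  define e where "e i j = (if (i \<le> k) = (j \<le> k) then 1 / (v j - v i) else 0)" for i j
  have lim: "((\<lambda>t. 1 / (z t j - z t i)) \<longlongrightarrow> e i j) at_top" for i j
  proof -
    have 1: "((\<lambda>t. 1 / (a + t)) \<longlongrightarrow> 0) at_top" for a :: real
      by (intro tendsto_divide_0[OF tendsto_const] filterlim_at_top_imp_at_infinity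
          filterlim_tendsto_add_at_top[OF tendsto_const] filterlim_ident)
    have 2: "((\<lambda>t. 1 / (a - t)) \<longlongrightarrow> 0) at_top" for a :: real
      using tendsto_minus[OF 1[of "- a"]] by (simp add: minus_divide_right)
    show ?thesis
      using 1[of "v j - v i"] 2[of "v j - v i"] by (auto simp: z_def e_def algebra_simps)
  qed
  have inj: "\<forall>\<^sub>F t in at_top. inj_on (z t) {..?n}"
  proof -
    \<comment> \<open>Only collisions between the two blocks can arise, and none is left once
      \<open>t\<close> exceeds all the finitely many \<open>v i - v j\<close>.\<close>
    have "\<forall>\<^sub>F t in at_top. \<forall>i\<in>{..k}. \<forall>j\<in>{Suc k..?n}. v i - v j < t"
      by (intro eventually_ball_finite ballI eventually_gt_at_top) auto
    then show ?thesis
    proof (rule eventually_mono)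
      fix t assume t: "\<forall>i\<in>{..k}. \<forall>j\<in>{Suc k..?n}. v i - v j < t"
      show "inj_on (z t) {..?n}"
      proof (rule linorder_inj_onI)
        fix i j assume ij: "i < j" "i \<in> {..?n}" "j \<in> {..?n}"
        consider "j \<le> k" | "i \<le> k" "k < j" | "k < i" using ij(1) by linarith
        then show "z t i \<noteq> z t j"
        proof cases
          case 1
          then show ?thesis using ij inj_on_distinct[OF y, of i j] by (simp add: z_def v_def)
        next
          case 2
          then have "v i - v j < t" using ij t by auto
          then show ?thesis using 2 by (simp add: z_def)
        next
          case 3
          then show ?thesis using ij inj_on_distinct[OF w, of "i - Suc k" "j - Suc k"] by (simp add: z_def v_def)
        qed
      qed (simp add: linear)
    qed
  qed
  let ?L = "\<lambda>T. if size (left T) = k then tree_frac (left T) y * tree_frac (right T) w else 0"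
  have term_lim: "((\<lambda>t. tree_frac T (z t) * (z t ?n - z t 0)) \<longlongrightarrow> ?L T) at_top" if T_in: "T \<in> pbtrees ?n" for T
  proof -
    obtain A B where T: "T = graft A B" using T_in by (cases T) (auto simp: pbtrees_def)
    have size: "size A + size B = k + l" using T_in by (simp add: T pbtrees_def)
    let ?z = "\<lambda>t i. z t (i + Suc (size A))"
    have "((\<lambda>t. tree_frac A (z t) * tree_frac B (?z t)) \<longlongrightarrow> ?L T) at_top"
    proof (cases "size A = k")
      case True
      have "tree_frac A (z t) = tree_frac A y" for t
        using True tree_frac_cong[of A "z t" "\<lambda>i. y i - t"] by (simp add: z_def v_def tree_frac_translate)
      moreover have "tree_frac B (?z t) = tree_frac B w" for t
        using True by (intro tree_frac_cong) (simp add: z_def v_def)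
      ultimately show ?thesis using True by (simp add: T)
    next
      case False
      note lim' = lim[of "_ + Suc (size A)" "_ + Suc (size A)"]
      obtain L M where L: "((\<lambda>t. tree_frac A (z t)) \<longlongrightarrow> L) at_top"
        and M: "((\<lambda>t. tree_frac B (?z t)) \<longlongrightarrow> M) at_top"
        using tree_frac_convergent[of z, OF lim] tree_frac_convergent[of ?z, OF lim'] by blast
      \<comment> \<open>If \<open>size A < k\<close>, the extreme leaves of \<open>B\<close> lie in
        different blocks; if \<open>size A > k\<close>, those of \<open>A\<close> do. The root
        factor of that subtree vanishes in the limit.\<close>
      have "L = 0 \<or> M = 0"
      proof (cases "size A < k")
        case True
        then have "B \<noteq> Leaf" "e (0 + Suc (size A)) (size B + Suc (size A)) = 0"
          using size by (auto simp: e_def)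
        then have "((\<lambda>t. tree_frac B (?z t)) \<longlongrightarrow> 0) at_top"
          by (rule tree_frac_tendsto_0[of ?z, OF lim'])
        then show ?thesis using tendsto_unique[OF _ M] by auto
      next
        case False
        then have "A \<noteq> Leaf" "e 0 (size A) = 0"
          using \<open>size A \<noteq> k\<close> by (auto simp: e_def)
        then have "((\<lambda>t. tree_frac A (z t)) \<longlongrightarrow> 0) at_top"
          by (rule tree_frac_tendsto_0[of z, OF lim])
        then show ?thesis using tendsto_unique[OF _ L] by auto
      qed
      then show ?thesis using tendsto_mult[OF L M] False by (auto simp: T)
    qed
    moreover have "\<forall>\<^sub>F t in at_top. tree_frac A (z t) * tree_frac B (?z t) =
        tree_frac T (z t) * (z t ?n - z t 0)"
      using inj
    proof (rule eventually_mono)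
      fix t assume "inj_on (z t) {..?n}"
      from inj_on_distinct[OF this, of 0 ?n]
      show "tree_frac A (z t) * tree_frac B (?z t) = tree_frac T (z t) * (z t ?n - z t 0)"
        by (simp add: T size)
    qed
    ultimately show ?thesis by (rule Lim_transform_eventually)
  qed
  have "((\<lambda>t. \<Sum>T\<in>pbtrees ?n. c T * (tree_frac T (z t) * (z t ?n - z t 0))) \<longlongrightarrow>
      (\<Sum>T\<in>pbtrees ?n. c T * ?L T)) at_top"
    by (intro tendsto_sum tendsto_mult tendsto_const term_lim)
  moreover have "\<forall>\<^sub>F t in at_top. (\<Sum>T\<in>pbtrees ?n. c T * (tree_frac T (z t) * (z t ?n - z t 0))) = 0"
    using inj by (rule eventually_mono) (use zero in \<open>simp add: mult.assoc[symmetric] sum_distrib_right[symmetric]\<close>)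
  ultimately have "(\<Sum>T\<in>pbtrees ?n. c T * ?L T) = 0"
    using tendsto_unique[OF trivial_limit_at_top_linorder _ tendsto_eventually] by blast
  moreover have "c T * ?L T = (if size (left T) = k
      then c (graft (left T) (right T)) * (tree_frac (left T) y * tree_frac (right T) w) else 0)"
    if "T \<in> pbtrees ?n" for T
    using that by (cases T) (auto simp: pbtrees_def)
  ultimately show ?thesis
    using sum_graft[where k = k and l = l and f = "\<lambda>A B. c (graft A B) * (tree_frac A y * tree_frac B w)"] by simp
qed

text \<open>Strong induction: \<open>tree_frac_separate\<close> is taken at the sizes of the two
  subtrees. Independence in \<open>w\<close> with \<open>y\<close> fixed, and then in
  \<open>y\<close>, isolates the coefficient of \<open>graft A B\<close>.\<close>

lemma tree_frac_independent:
  fixes c :: "pbtree \<Rightarrow> real"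
  assumes "\<And>x. inj_on x {..n} \<Longrightarrow> (\<Sum>T\<in>pbtrees n. c T * tree_frac T x) = 0" "T \<in> pbtrees n"
  shows "c T = 0"
  using assms
proof (induction n arbitrary: c T rule: less_induct)
  case (less n)
  show ?case
  proof (cases T)
    case Leaf
    then have "n = 0" "pbtrees n = {Leaf}" using less.prems(2) by (auto simp: pbtrees_def)
    \<comment> \<open>The embedding \<open>real\<close> serves as a point with distinct
      coordinates.\<close>
    then show ?thesis using less.prems(1)[of real] Leaf by simp
  next
    case (Node A a B)
    let ?k = "size A" and ?l = "size B"
    have n: "n = Suc (?k + ?l)" using less.prems(2) Node by (simp add: pbtrees_def)
    have "(\<Sum>A'\<in>pbtrees ?k. c (graft A' B) * tree_frac A' y) = 0" if y: "inj_on y {..?k}" for y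
    proof (rule less.IH[of ?l "\<lambda>B'. \<Sum>A'\<in>pbtrees ?k. c (graft A' B') * tree_frac A' y" B])
      fix w :: "nat \<Rightarrow> real" assume w: "inj_on w {..?l}"
      have "(\<Sum>A'\<in>pbtrees ?k. \<Sum>B'\<in>pbtrees ?l. c (graft A' B') * (tree_frac A' y * tree_frac B' w)) = 0"
        by (rule tree_frac_separate[OF _ y w]) (rule less.prems(1)[unfolded n])
      then show "(\<Sum>B'\<in>pbtrees ?l. (\<Sum>A'\<in>pbtrees ?k. c (graft A' B') * tree_frac A' y) * tree_frac B' w) = 0"
        by (subst (asm) sum.swap) (simp add: sum_distrib_right mult.assoc)
    qed (auto simp: n pbtrees_def)
    from less.IH[of ?k "\<lambda>A'. c (graft A' B)" A, OF _ this] show ?thesis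
      using Node by (simp add: n pbtrees_def)
  qed
qed

section \<open>The Coxeter transformation on rational functions\<close>

text \<open>The image of \<open>tree_frac T\<close> under \<open>\<theta>\<close>, as
  \<open>cox_frac_coxeter\<close> and \<open>cox_unique\<close> together imply. The value at
  \<open>Leaf\<close> reflects that \<open>\<theta>\<close> is -1 on a one-point poset.\<close>

primrec cox_frac :: "pbtree \<Rightarrow> (nat \<Rightarrow> real) \<Rightarrow> real" where
  "cox_frac Leaf x = -1"
| "cox_frac (Node l a r) x =
     - cox_frac l (x(0 := x (Suc (size l)))) * cox_frac r (\<lambda>i. x (i + Suc (size l))) / (x (Suc (size l)) - x 0)"

text \<open>The linear span of the pairs \<open>(tree_frac T, cox_frac T)\<close>, where functions are identified if they
  agree at all points with distinct coordinates \<open>x\<^sub>0, \<dots>, x\<^sub>n\<close>. It is the graph of a linear map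
  (lemma \<open>cox_unique\<close>), which turns out to be \<open>\<theta>\<close>.\<close>

inductive cox :: "nat \<Rightarrow> ((nat \<Rightarrow> real) \<Rightarrow> real) \<Rightarrow> ((nat \<Rightarrow> real) \<Rightarrow> real) \<Rightarrow> bool" for n where
  tree: "size T = n \<Longrightarrow> cox n (tree_frac T) (cox_frac T)"
| comb: "cox n f f' \<Longrightarrow> cox n g g' \<Longrightarrow> cox n (\<lambda>x. a * f x + b * g x) (\<lambda>x. a * f' x + b * g' x)"
| cong: "cox n f f' \<Longrightarrow> (\<And>x. inj_on x {..n} \<Longrightarrow> f x = g x \<and> f' x = g' x) \<Longrightarrow> cox n g g'"

lemma cox_add: "cox n f f' \<Longrightarrow> cox n g g' \<Longrightarrow> cox n (\<lambda>x. f x + g x) (\<lambda>x. f' x + g' x)"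
  using cox.comb[of n f f' g g' 1 1] by simp

lemma cox_zero: "cox n (\<lambda>x. 0) (\<lambda>x. 0)"
proof -
  \<comment> \<open>The zero pair is obtained as 0 times the pair of a tree, so some tree with
    \<open>n\<close> vertices has to exist.\<close>
  have "\<exists>T::pbtree. size T = n"
  proof (induction n)
    case (Suc n)
    then obtain T :: pbtree where "size T = n" by blast
    then show ?case by (intro exI[of _ "graft Leaf T"]) simp
  qed simp
  then obtain T :: pbtree where "size T = n" by blast
  from cox.comb[OF cox.tree[OF this] cox.tree[OF this], of 0 0] show ?thesis by simp
qed

lemma cox_sum:
  "(\<And>i. i \<in> I \<Longrightarrow> cox n (f i) (f' i)) \<Longrightarrow> cox n (\<lambda>x. \<Sum>i\<in>I. c i * f i x) (\<lambda>x. \<Sum>i\<in>I. c i * f' i x)"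
proof (induction I rule: infinite_finite_induct)
  case (insert i I)
  then show ?case using cox.comb[of n "f i" "f' i" _ _ "c i" 1] by simp
qed (simp_all add: cox_zero)

text \<open>Both components are linear in the pair \<open>(f, f')\<close>, so trees suffice. The
  last assumption keeps the substituted points distinct, as the rule \<open>cong\<close>
  requires.\<close>

lemma cox_extend:
  assumes "cox k f f'"
    and "\<And>T. size T = k \<Longrightarrow> cox n (\<lambda>x. u x * tree_frac T (s x)) (\<lambda>x. u' x * cox_frac T (s' x))"
    and "\<And>x. inj_on x {..n} \<Longrightarrow> inj_on (s x) {..k} \<and> inj_on (s' x) {..k}"
  shows "cox n (\<lambda>x. u x * f (s x)) (\<lambda>x. u' x * f' (s' x))"
  using assms(1)
proof induction
  case (comb f f' g g' a b)
  from cox.comb[OF comb.IH, of a b] show ?case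
    by (simp add: algebra_simps)
next
  case (cong f f' g g')
  from cong.IH show ?case
    by (rule cox.cong) (use cong.hyps assms(3) in auto)
qed (use assms(2) in auto)

section \<open>Products inside the graph\<close>

lemma inj_on_fun_upd_last:
  "inj_on x {..n} \<Longrightarrow> k < m \<Longrightarrow> m \<le> n \<Longrightarrow> inj_on (x(0 := x m)) {..k::nat}"
  by (rule inj_onI) (auto simp: inj_on_eq_iff split: if_splits)

lemma inj_on_fun_upd_first:
  fixes x :: "nat \<Rightarrow> 'a"
  assumes "inj_on x {..n}" "k + l \<le> n"
  shows "inj_on ((\<lambda>i. x (i + k))(0 := x 0)) {..l}"
  using assms by (intro inj_onI) (auto simp: inj_on_eq_iff split: if_splits)

text \<open>For two trees this is the recursion of \<open>cox_frac\<close>;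
  \<open>cox_extend\<close> carries it to all pairs, first in \<open>g\<close>, then in
  \<open>f\<close>.\<close>

lemma cox_graft:
  assumes f: "cox k f f'" and g: "cox l g g'" and n: "n = Suc (k + l)"
  shows "cox n (\<lambda>x. f x * g (\<lambda>i. x (i + Suc k)) / (x n - x 0))
    (\<lambda>x. - f' (x(0 := x (Suc k))) * g' (\<lambda>i. x (i + Suc k)) / (x (Suc k) - x 0))"
proof -
  have tree: "cox n (\<lambda>x. tree_frac S x / (x n - x 0) * g (\<lambda>i. x (i + Suc k)))
      (\<lambda>x. - cox_frac S (x(0 := x (Suc k))) / (x (Suc k) - x 0) * g' (\<lambda>i. x (i + Suc k)))"
    if S: "size S = k" for S
  proof (rule cox_extend[OF g])
    fix T :: pbtree assume "size T = l"
    then show "cox n (\<lambda>x. tree_frac S x / (x n - x 0) * tree_frac T (\<lambda>i. x (i + Suc k)))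
        (\<lambda>x. - cox_frac S (x(0 := x (Suc k))) / (x (Suc k) - x 0) * cox_frac T (\<lambda>i. x (i + Suc k)))"
      using S n by (intro cox.cong[OF cox.tree[of "graft S T"]]) simp_all
  next
    fix x :: "nat \<Rightarrow> real" assume "inj_on x {..n}"
    from inj_on_shift[OF this, of "Suc k" l]
    show "inj_on (\<lambda>i. x (i + Suc k)) {..l} \<and> inj_on (\<lambda>i. x (i + Suc k)) {..l}"
      using n by simp
  qed
  have "cox n (\<lambda>x. g (\<lambda>i. x (i + Suc k)) / (x n - x 0) * f x)
      (\<lambda>x. - g' (\<lambda>i. x (i + Suc k)) / (x (Suc k) - x 0) * f' (x(0 := x (Suc k))))"
    by (rule cox_extend[OF f], rule cox.cong[OF tree])
      (use n in \<open>auto simp: mult.commute intro: inj_on_initial inj_on_fun_upd_last\<close>)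
  then show ?thesis by (rule cox.cong) (simp add: mult.commute)
qed

text \<open>\<open>triangle\<close> with \<open>b\<close> and \<open>c\<close> exchanged, then
  rearranged: the form needed for the images.\<close>

lemma triangle':
  fixes u a b c :: real
  assumes "a \<noteq> b" "b \<noteq> c" "a \<noteq> c"
  shows "u / (b - c) / (c - a) + u / (c - b) / (b - a) = u / (b - a) / (c - a)"
proof -
  have "b - a \<noteq> 0" "c - b \<noteq> 0" "b - c \<noteq> 0" "c - a \<noteq> 0" using assms by auto
  then show ?thesis by (simp add: divide_simps) (simp add: algebra_simps)
qed

text \<open>Induction along the right spine. By \<open>triangle\<close>, the product for
  \<open>graft A B\<close> is the graft of that tree with \<open>g\<close> plus the graft of
  \<open>A\<close> with the product for \<open>B\<close>; \<open>triangle'\<close> adds up the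
  images.\<close>

lemma cox_up_tree:
  "cox l g g' \<Longrightarrow> n = Suc (size T + l) \<Longrightarrow>
   cox n (\<lambda>x. tree_frac T x * g (\<lambda>i. x (i + Suc (size T))) / (x n - x (size T)))
     (\<lambda>x. - cox_frac T x * g' (\<lambda>i. x (i + Suc (size T))) / (x (Suc (size T)) - x 0))"
proof (induction T arbitrary: n)
  case Leaf
  then show ?case using cox_graft[OF cox.tree[of Leaf 0] Leaf.prems(1)] by simp
next
  case (Node A a B)
  let ?p = "Suc (size A)" and ?k = "Suc (size A + size B)"
  have n: "n = Suc (size (graft A B) + l)" "n = Suc (size A + Suc (size B + l))"
    using Node.prems by simp_all
  note sum = cox_add[OF cox_graft[OF cox.tree[OF refl] Node.prems(1) n(1)]
    cox_graft[OF cox.tree[OF refl] Node.IH(2)[OF Node.prems(1) refl] n(2)]]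
  show ?case
  proof (rule cox.cong[OF sum], rule conjI, goal_cases)
    case (1 x)
    let ?u = "tree_frac A x * tree_frac B (\<lambda>i. x (i + ?p)) * g (\<lambda>i. x (i + Suc ?k))"
    have "x 0 \<noteq> x ?k" "x ?k \<noteq> x n" "x 0 \<noteq> x n"
      using inj_on_distinct[OF 1] n by auto
    from triangle[OF this, of ?u] show ?case
      using n by (simp add: ac_simps)
  next
    case (2 x)
    let ?u = "cox_frac A (x(0 := x ?p)) * cox_frac B (\<lambda>i. x (i + ?p)) * g' (\<lambda>i. x (i + Suc ?k))"
    have "x 0 \<noteq> x ?p" "x ?p \<noteq> x (Suc ?k)" "x 0 \<noteq> x (Suc ?k)"
      using inj_on_distinct[OF 2] n by auto
    from triangle'[OF this, of ?u] show ?case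
      using n by (simp add: ac_simps)
  qed
qed

text \<open>The first product is the one that builds \<open>upset_frac\<close>; up to sign, its
  image is the one that builds \<open>downset_frac\<close>.\<close>

lemma cox_up:
  assumes f: "cox k f f'" and g: "cox l g g'" and n: "n = Suc (k + l)"
  shows "cox n (\<lambda>x. f x * g (\<lambda>i. x (i + Suc k)) / (x n - x k))
    (\<lambda>x. - f' x * g' (\<lambda>i. x (i + Suc k)) / (x (Suc k) - x 0))"
proof -
  have "cox n (\<lambda>x. g (\<lambda>i. x (i + Suc k)) / (x n - x k) * f x)
      (\<lambda>x. - g' (\<lambda>i. x (i + Suc k)) / (x (Suc k) - x 0) * f' x)"
  proof (rule cox_extend[OF f])
    fix T :: pbtree assume "size T = k"
    then show "cox n (\<lambda>x. g (\<lambda>i. x (i + Suc k)) / (x n - x k) * tree_frac T x)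
      (\<lambda>x. - g' (\<lambda>i. x (i + Suc k)) / (x (Suc k) - x 0) * cox_frac T x)"
      using n by (intro cox.cong[OF cox_up_tree[OF g, of n T]]) (simp_all add: mult.commute)
  qed (use n in \<open>auto intro: inj_on_initial\<close>)
  then show ?thesis by (rule cox.cong) (simp add: mult.commute)
qed

text \<open>Now along the left spine: the product for \<open>graft A B\<close> is the graft of the
  product for \<open>A\<close> with \<open>B\<close>, plus the graft of \<open>f\<close> with
  \<open>graft A B\<close>. In the image the two blocks have exchanged \<open>x_0\<close> and
  \<open>x_(k+1)\<close>.\<close>

lemma cox_down_tree:
  "cox k f f' \<Longrightarrow> n = Suc (k + size T) \<Longrightarrow>
   cox n (\<lambda>x. f x * tree_frac T (\<lambda>i. x (i + Suc k)) / (x (Suc k) - x 0))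
     (\<lambda>x. - f' (x(0 := x (Suc k))) * cox_frac T ((\<lambda>i. x (i + Suc k))(0 := x 0)) / (x (Suc k) - x 0))"
proof (induction T arbitrary: n)
  case Leaf
  then show ?case using cox_graft[OF Leaf.prems(1) cox.tree[of Leaf 0], of n] by simp
next
  case (Node A a B)
  let ?c = "Suc k" and ?d = "Suc (Suc (k + size A))"
  have n: "n = Suc (Suc (k + size A) + size B)" "n = Suc (k + size (graft A B))"
    using Node.prems by simp_all
  note sum = cox_add[OF cox_graft[OF Node.IH(1)[OF Node.prems(1) refl] cox.tree[OF refl] n(1)]
    cox_graft[OF Node.prems(1) cox.tree[OF refl] n(2)]]
  show ?case
  proof (rule cox.cong[OF sum], rule conjI, goal_cases)
    case (1 x)
    let ?u = "f x * tree_frac A (\<lambda>i. x (i + ?c)) * tree_frac B (\<lambda>i. x (i + ?d))"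
    have "x 0 \<noteq> x ?c" "x ?c \<noteq> x n" "x 0 \<noteq> x n"
      using inj_on_distinct[OF 1] n by auto
    from triangle[OF this, of ?u] show ?case
      using n by (simp add: ac_simps)
  next
    case (2 x)
    let ?u = "f' (x(0 := x ?c)) * cox_frac A ((\<lambda>i. x (i + ?c))(0 := x ?d)) * cox_frac B (\<lambda>i. x (i + ?d))"
    have "x 0 \<noteq> x ?c" "x ?c \<noteq> x ?d" "x 0 \<noteq> x ?d"
      using inj_on_distinct[OF 2] n by auto
    from triangle'[OF this, of ?u] show ?case
      using n by (simp add: ac_simps fun_upd_def cong: if_cong)
  qed
qed

lemma cox_down:
  assumes f: "cox k f f'" and g: "cox l g g'" and n: "n = Suc (k + l)"
  shows "cox n (\<lambda>x. f x * g (\<lambda>i. x (i + Suc k)) / (x (Suc k) - x 0))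
    (\<lambda>x. - f' (x(0 := x (Suc k))) * g' ((\<lambda>i. x (i + Suc k))(0 := x 0)) / (x (Suc k) - x 0))"
proof -
  have "cox n (\<lambda>x. f x / (x (Suc k) - x 0) * g (\<lambda>i. x (i + Suc k)))
      (\<lambda>x. - f' (x(0 := x (Suc k))) / (x (Suc k) - x 0) * g' ((\<lambda>i. x (i + Suc k))(0 := x 0)))"
  proof (rule cox_extend[OF g])
    fix T :: pbtree assume "size T = l"
    then show "cox n (\<lambda>x. f x / (x (Suc k) - x 0) * tree_frac T (\<lambda>i. x (i + Suc k)))
      (\<lambda>x. - f' (x(0 := x (Suc k))) / (x (Suc k) - x 0) * cox_frac T ((\<lambda>i. x (i + Suc k))(0 := x 0)))"
      using n by (intro cox.cong[OF cox_down_tree[OF f, of n T]]) simp_all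
  next
    fix x :: "nat \<Rightarrow> real" assume "inj_on x {..n}"
    from inj_on_shift[OF this, of "Suc k" l] inj_on_fun_upd_first[OF this, of "Suc k" l]
    show "inj_on (\<lambda>i. x (i + Suc k)) {..l} \<and> inj_on ((\<lambda>i. x (i + Suc k))(0 := x 0)) {..l}"
      using n by simp
  qed
  then show ?thesis by (rule cox.cong) simp
qed

text \<open>The counterpart of \<open>coxeter_projective\<close>: it ties the graph
  \<open>cox\<close> to \<open>\<theta>\<close>, since the upper set sums generate
  everything.\<close>

lemma cox_upset_frac: "cox (size T) (upset_frac T) (\<lambda>x. - downset_frac T x)"
proof (induction T)
  case Leaf
  show ?case by (rule cox.cong[OF cox.tree[of Leaf]]) simp_all
next
  case (Node A a B)
  have "size (Node A a B) = Suc (size A + size B)" by simp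
  from cox_up[OF Node.IH this] show ?case by (rule cox.cong) simp
qed

section \<open>The square of the Coxeter transformation is a rotation\<close>

text \<open>Coordinates beyond \<open>n\<close> stay fixed, so that \<open>n + 1\<close> iterations
  give the identity on whole sequences.\<close>

definition rotate_vars :: "nat \<Rightarrow> (nat \<Rightarrow> real) \<Rightarrow> nat \<Rightarrow> real" where
  "rotate_vars n x i = (if i \<le> n then x (Suc i mod Suc n) else x i)"

text \<open>Rotating the exchanged blocks \<open>x_(k+1), x_1, ..., x_k\<close> and
  \<open>x_0, x_(k+2), ..., x_n\<close> separately gives \<open>x_1, ..., x_(k+1)\<close> and
  \<open>x_(k+2), ..., x_n, x_0\<close>, which together form the rotation of all variables.\<close>

lemma cox_downset_frac:
  "cox (size T) (downset_frac T) (\<lambda>x. - ((-1) ^ size T) * upset_frac T (rotate_vars (size T) x))"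
proof (induction T)
  case Leaf
  show ?case by (rule cox.cong[OF cox.tree[of Leaf]]) simp_all
next
  case (Node A a B)
  let ?k = "size A" and ?l = "size B"
  let ?n = "Suc (?k + ?l)"
  have "size (Node A a B) = ?n" by simp
  from cox_down[OF Node.IH this] show ?case
  proof (rule cox.cong, intro conjI, goal_cases)
    case (2 x)
    have "upset_frac A (rotate_vars ?k (x(0 := x (Suc ?k)))) = upset_frac A (rotate_vars ?n x)"
      by (rule upset_frac_cong) (auto simp: rotate_vars_def mod_Suc)
    moreover have "upset_frac B (rotate_vars ?l ((\<lambda>i. x (i + Suc ?k))(0 := x 0))) =
        upset_frac B (\<lambda>i. rotate_vars ?n x (i + Suc ?k))"
      by (rule upset_frac_cong) (auto simp: rotate_vars_def mod_Suc ac_simps)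
    moreover have "rotate_vars ?n x ?n = x 0" "rotate_vars ?n x ?k = x (Suc ?k)"
      by (simp_all add: rotate_vars_def)
    \<comment> \<open>The rotated root factor has its ends in the opposite order, which costs one
      sign per vertex.\<close>
    moreover have "u / (x 0 - x (Suc ?k)) = - (u / (x (Suc ?k) - x 0))" for u
      by (metis minus_diff_eq minus_divide_right)
    ultimately show ?case by (simp add: power_add fun_upd_def)
  qed simp
qed

text \<open>One family of coefficients serves both components, so a vanishing first component will
  force the second to vanish.\<close>

lemma cox_coefficients:
  assumes "cox n f f'"
  shows "\<exists>c. \<forall>x. inj_on x {..n} \<longrightarrow>
    f x = (\<Sum>T\<in>pbtrees n. c T * tree_frac T x) \<and> f' x = (\<Sum>T\<in>pbtrees n. c T * cox_frac T x)"
  using assms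
proof induction
  case (tree T)
  have "(\<Sum>U\<in>pbtrees n. (if U = T then 1 else 0) * h U) = h T" for h :: "pbtree \<Rightarrow> real"
    using tree finite_pbtrees by (simp add: pbtrees_def if_distrib[of "\<lambda>a. a * _"] cong: if_cong)
  then show ?case by (intro exI[of _ "\<lambda>U. if U = T then 1 else 0"]) simp
next
  case (comb f f' g g' a b)
  then obtain c d where "\<forall>x. inj_on x {..n} \<longrightarrow>
      f x = (\<Sum>T\<in>pbtrees n. c T * tree_frac T x) \<and> f' x = (\<Sum>T\<in>pbtrees n. c T * cox_frac T x)"
    "\<forall>x. inj_on x {..n} \<longrightarrow>
      g x = (\<Sum>T\<in>pbtrees n. d T * tree_frac T x) \<and> g' x = (\<Sum>T\<in>pbtrees n. d T * cox_frac T x)"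
    by blast
  then show ?case
    by (intro exI[of _ "\<lambda>T. a * c T + b * d T"]) (simp add: distrib_right sum.distrib sum_distrib_left mult.assoc)
next
  case (cong f f' g g')
  then obtain c where "\<forall>x. inj_on x {..n} \<longrightarrow>
      f x = (\<Sum>T\<in>pbtrees n. c T * tree_frac T x) \<and> f' x = (\<Sum>T\<in>pbtrees n. c T * cox_frac T x)"
    by blast
  then show ?case using cong.hyps by (intro exI[of _ c]) simp
qed

text \<open>The difference of the two pairs has first component 0, so by linear independence all its
  coefficients vanish.\<close>

lemma cox_unique:
  assumes "cox n f f'" "cox n f f''" "inj_on x {..n}"
  shows "f' x = f'' x"
proof -
  obtain c where c: "\<And>y. inj_on y {..n} \<Longrightarrow> 1 * f y + (-1) * f y = (\<Sum>T\<in>pbtrees n. c T * tree_frac T y)"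
    "\<And>y. inj_on y {..n} \<Longrightarrow> 1 * f' y + (-1) * f'' y = (\<Sum>T\<in>pbtrees n. c T * cox_frac T y)"
    using cox_coefficients[OF cox.comb[OF assms(1,2), of 1 "-1"]] by blast
  have "c T = 0" if "T \<in> pbtrees n" for T
    by (rule tree_frac_independent[OF _ that]) (use c(1) in simp)
  then show ?thesis using c(2)[OF assms(3)] by simp
qed


section \<open>From the Grothendieck group to functions\<close>

lemma matrix_map_sum:
  assumes "finite P" "Poly_Mapping.keys X \<subseteq> P"
  shows "(\<Sum>T\<in>P. of_int (poly_mapping.lookup (matrix_map P M X) T) * f T) =
    (\<Sum>S\<in>P. of_int (poly_mapping.lookup X S) * (\<Sum>T\<in>P. of_int (M T S) * f T :: real))"
proof -
  have "(\<Sum>T\<in>P. of_int (poly_mapping.lookup (matrix_map P M X) T) * f T) =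
      (\<Sum>T\<in>P. \<Sum>S\<in>P. of_int (M T S) * of_int (poly_mapping.lookup X S) * f T)"
    by (intro sum.cong refl) (simp add: lookup_matrix_map[OF assms] sum_distrib_right)
  also have "\<dots> = (\<Sum>S\<in>P. \<Sum>T\<in>P. of_int (M T S) * of_int (poly_mapping.lookup X S) * f T)"
    by (rule sum.swap)
  finally show ?thesis by (simp add: sum_distrib_left ac_simps)
qed

text \<open>The linear map sending the class of the simple module at \<open>T\<close> to
  \<open>tree_frac T\<close>; it is injective by \<open>frag_frac_eq_imp_eq\<close>.\<close>

definition frag_frac :: "nat \<Rightarrow> (pbtree \<Rightarrow>\<^sub>0 int) \<Rightarrow> (nat \<Rightarrow> real) \<Rightarrow> real" where
  "frag_frac n X x = (\<Sum>T\<in>pbtrees n. of_int (poly_mapping.lookup X T) * tree_frac T x)"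

text \<open>Column \<open>T\<close> of the order matrix is the indicator of the lower set of
  \<open>T\<close>, and column \<open>T\<close> of its transpose that of the upper set.\<close>

lemma frag_frac_order_matrix:
  assumes "Poly_Mapping.keys X \<subseteq> pbtrees n" "inj_on x {..n}"
  shows "frag_frac n (matrix_map (pbtrees n) (order_matrix tamari_le) X) x =
      (\<Sum>T\<in>pbtrees n. of_int (poly_mapping.lookup X T) * downset_frac T x)"
    and "frag_frac n (matrix_map (pbtrees n) (transpose_matrix (order_matrix tamari_le)) X) x =
      (\<Sum>T\<in>pbtrees n. of_int (poly_mapping.lookup X T) * upset_frac T x)"
proof -
  have "(\<Sum>U\<in>pbtrees n. of_int (order_matrix tamari_le U T) * tree_frac U x) = downset_frac T x"
    if "T \<in> pbtrees n" for T
  proof -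
    have "(\<Sum>U\<in>pbtrees n. of_int (order_matrix tamari_le U T) * tree_frac U x) =
        (\<Sum>U | tamari_le U T. tree_frac U x)"
      using that finite_pbtrees
      by (intro sum.mono_neutral_cong_right) (auto simp: order_matrix_def pbtrees_def dest: size_tamari_le)
    then show ?thesis using sum_tamari_down[of x T] assms(2) that by (simp add: pbtrees_def)
  qed
  then show "frag_frac n (matrix_map (pbtrees n) (order_matrix tamari_le) X) x =
      (\<Sum>T\<in>pbtrees n. of_int (poly_mapping.lookup X T) * downset_frac T x)"
    unfolding frag_frac_def matrix_map_sum[OF finite_pbtrees assms(1)] by simp
next
  have "(\<Sum>U\<in>pbtrees n. of_int (transpose_matrix (order_matrix tamari_le) U T) * tree_frac U x) = upset_frac T x"
    if "T \<in> pbtrees n" for T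
  proof -
    have "(\<Sum>U\<in>pbtrees n. of_int (transpose_matrix (order_matrix tamari_le) U T) * tree_frac U x) =
        (\<Sum>U | tamari_le T U. tree_frac U x)"
      using that finite_pbtrees
      by (intro sum.mono_neutral_cong_right)
        (auto simp: transpose_matrix_def order_matrix_def pbtrees_def dest: size_tamari_le)
    then show ?thesis using sum_tamari_up[of x T] assms(2) that by (simp add: pbtrees_def)
  qed
  then show "frag_frac n (matrix_map (pbtrees n) (transpose_matrix (order_matrix tamari_le)) X) x =
      (\<Sum>T\<in>pbtrees n. of_int (poly_mapping.lookup X T) * upset_frac T x)"
    unfolding frag_frac_def matrix_map_sum[OF finite_pbtrees assms(1)] by simp
qed

lemma inj_on_rotate_vars:
  assumes "inj_on x {..n}"
  shows "inj_on (rotate_vars n x) {..n}"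
proof (rule inj_onI)
  fix i j assume ij: "i \<in> {..n}" "j \<in> {..n}" "rotate_vars n x i = rotate_vars n x j"
  then have "Suc i mod Suc n = Suc j mod Suc n"
    using inj_onD[OF assms, of "Suc i mod Suc n" "Suc j mod Suc n"] by (simp add: rotate_vars_def less_Suc_eq_le[symmetric])
  then show "i = j" using ij(1,2) by (auto simp: mod_Suc split: if_splits)
qed

lemma rotate_vars_power:
  "(rotate_vars n ^^ m) x i = (if i \<le> n then x ((i + m) mod Suc n) else x i)"
proof (induction m arbitrary: i)
  case (Suc m)
  have "Suc i mod Suc n \<le> n" by (simp add: less_Suc_eq_le[symmetric])
  moreover have "(Suc i mod Suc n + m) mod Suc n = (i + Suc m) mod Suc n"
    by (simp add: mod_add_left_eq)
  ultimately show ?case using Suc by (simp add: rotate_vars_def)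
qed simp

lemma frag_frac_eq_imp_eq:
  assumes "Poly_Mapping.keys X \<subseteq> pbtrees n" "Poly_Mapping.keys Y \<subseteq> pbtrees n"
    and "\<And>x. inj_on x {..n} \<Longrightarrow> frag_frac n X x = frag_frac n Y x"
  shows "X = Y"
proof (rule poly_mapping_eqI)
  fix T
  show "poly_mapping.lookup X T = poly_mapping.lookup Y T"
  proof (cases "T \<in> pbtrees n")
    case True
    have "real_of_int (poly_mapping.lookup X T) - of_int (poly_mapping.lookup Y T) = 0"
      using assms(3)
      by (intro tree_frac_independent[OF _ True, of "\<lambda>T. of_int (poly_mapping.lookup X T) - of_int (poly_mapping.lookup Y T)"])
        (simp add: frag_frac_def left_diff_distrib sum_subtractf)
    then show ?thesis by simp
  next
    case False
    then show ?thesis using assms(1,2) by (metis in_keys_iff subsetD)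
  qed
qed

section \<open>Iterating the transformation\<close>

context
  fixes n :: nat
begin

abbreviation (input) \<theta> :: "(pbtree \<Rightarrow>\<^sub>0 int) \<Rightarrow> (pbtree \<Rightarrow>\<^sub>0 int)" where
  "\<theta> \<equiv> coxeter_transformation (pbtrees n) tamari_le"

interpretation finite_poset "pbtrees n" tamari_le
  by (rule finite_poset_tamari)

lemma coxeter_transformation_Lt: "Y \<in> K \<Longrightarrow> \<theta> (Lt Y) = - L Y"
  unfolding coxeter_transformation_def by (simp only: inv_into_f_f[OF inj_on_transpose_order_matrix])

lemma frag_frac_minus: "frag_frac n (- X) x = - frag_frac n X x"
  by (simp add: frag_frac_def sum_negf)

lemma coxeter_closed: "X \<in> K \<Longrightarrow> \<theta> X \<in> K"
proof -
  assume "X \<in> K"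
  then obtain Y where "Y \<in> K" "X = Lt Y" using surj_on_transpose_order_matrix by blast
  then show ?thesis using coxeter_transformation_Lt matrix_map_closed[of Y "order_matrix tamari_le"] by simp
qed

text \<open>Writing \<open>X = Lt Y\<close> expresses \<open>X\<close> through
  \<open>upset_frac\<close> and \<open>\<theta> X = - L Y\<close> through
  \<open>downset_frac\<close>, with the same coefficients up to sign.\<close>

lemma cox_frac_coxeter:
  assumes "X \<in> K"
  shows "cox n (frag_frac n X) (frag_frac n (\<theta> X))"
    and "cox n (frag_frac n (\<theta> X)) (\<lambda>x. (-1) ^ n * frag_frac n X (rotate_vars n x))"
proof -
  obtain Y where Y: "Y \<in> K" "X = Lt Y"
    using assms surj_on_transpose_order_matrix by blast
  then have keys: "Poly_Mapping.keys Y \<subseteq> pbtrees n" by simp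
  let ?c = "\<lambda>T. real_of_int (poly_mapping.lookup Y T)"
  have \<theta>: "\<theta> (Lt Y) = - L Y" using coxeter_transformation_Lt Y(1) by simp
  have "cox n (\<lambda>x. \<Sum>T\<in>pbtrees n. ?c T * upset_frac T x) (\<lambda>x. \<Sum>T\<in>pbtrees n. ?c T * (- downset_frac T x))"
    by (rule cox_sum) (use cox_upset_frac in \<open>auto simp: pbtrees_def\<close>)
  then show "cox n (frag_frac n X) (frag_frac n (\<theta> X))"
    by (rule cox.cong) (simp add: \<theta> Y(2) frag_frac_minus frag_frac_order_matrix[OF keys] sum_negf)
  have "cox n (\<lambda>x. \<Sum>T\<in>pbtrees n. - ?c T * downset_frac T x)
      (\<lambda>x. \<Sum>T\<in>pbtrees n. - ?c T * (- ((-1) ^ n) * upset_frac T (rotate_vars n x)))"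
    by (rule cox_sum) (use cox_downset_frac in \<open>auto simp: pbtrees_def\<close>)
  then show "cox n (frag_frac n (\<theta> X)) (\<lambda>x. (-1) ^ n * frag_frac n X (rotate_vars n x))"
    by (rule cox.cong)
      (simp add: \<theta> Y(2) frag_frac_minus frag_frac_order_matrix[OF keys] inj_on_rotate_vars sum_negf sum_distrib_left ac_simps)
qed

text \<open>The graph holds two pairs with first component \<open>frag_frac n (\<theta> X)\<close>:
  part one applied to \<open>\<theta> X\<close>, and part two applied to \<open>X\<close>.
  Uniqueness equates their images.\<close>

lemma frag_frac_coxeter_twice:
  "X \<in> K \<Longrightarrow> inj_on x {..n} \<Longrightarrow> frag_frac n (\<theta> (\<theta> X)) x = (-1) ^ n * frag_frac n X (rotate_vars n x)"
  using cox_unique[OF cox_frac_coxeter(1) cox_frac_coxeter(2)] coxeter_closed by blast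

lemma frag_frac_coxeter_even_power:
  assumes "X \<in> K"
  shows "(\<theta> ^^ (2 * m)) X \<in> K \<and>
    (\<forall>x. inj_on x {..n} \<longrightarrow> frag_frac n ((\<theta> ^^ (2 * m)) X) x = (-1) ^ (n * m) * frag_frac n X ((rotate_vars n ^^ m) x))"
proof (induction m)
  case (Suc m)
  let ?Z = "(\<theta> ^^ (2 * m)) X"
  have "?Z \<in> K" using Suc by blast
  have eq: "(\<theta> ^^ (2 * Suc m)) X = \<theta> (\<theta> ?Z)" by simp
  \<comment> \<open>The last two applications contribute one rotation, and the induction hypothesis
    is used at the rotated point, whose coordinates are still distinct.\<close>
  have "frag_frac n (\<theta> (\<theta> ?Z)) x = (-1) ^ (n * Suc m) * frag_frac n X ((rotate_vars n ^^ Suc m) x)"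
    if "inj_on x {..n}" for x
    using frag_frac_coxeter_twice[OF \<open>?Z \<in> K\<close> that] Suc inj_on_rotate_vars[OF that]
    by (simp only: funpow_Suc_right o_apply) (simp add: power_add)
  then show ?case
    unfolding eq using coxeter_closed \<open>?Z \<in> K\<close> by blast
qed (use assms in simp)

end

theorem corollary6p2:
  fixes n :: nat
  shows "\<forall>x \<in> carrier (grothendieck_group (pbtrees n)).
           (coxeter_transformation (pbtrees n) tamari_le ^^ (2 * n + 2)) x = x"
proof
  fix X assume X: "X \<in> carrier (grothendieck_group (pbtrees n))"
  have "(rotate_vars n ^^ Suc n) x = x" for x
    by (rule ext) (simp only: rotate_vars_power mod_add_self2, simp)
  moreover have "(-1 :: real) ^ (n * Suc n) = 1" by simp
  moreover have "2 * n + 2 = 2 * Suc n" by simp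
  ultimately show "(coxeter_transformation (pbtrees n) tamari_le ^^ (2 * n + 2)) X = X"
    using frag_frac_coxeter_even_power[OF X, of "Suc n"] X
    by (intro frag_frac_eq_imp_eq[of _ n]) (simp_all del: funpow.simps mult_Suc_right)
qed

end
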